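(* Let $X,Y\subset \mathbb{R}^n$ be closed and convex, and suppose $X\cap Y \neq \emptyset$. Let $(z^k)_{k\in\mathbb{N}}$ be the sequence generated by the centralized circumcentered-reflection method (cCRM) starting from some $z^0\in\mathbb{R}^n$, i.e. $z^{k+1}=T(z^k)$, and converging to a point $\bar z \in X\cap Y$. Assume that the interior of $X\cap Y$ is nonempty, and that the boundaries of $X$ and $Y$ are differentiable manifolds in a neighborhood of $\bar z$. Then $(z^k)_{k\in\mathbb{N}}$ converges to $\bar z$ superlinearly.
   Context: $P_X,P_Y$ denote the orthogonal projections onto $X,Y$ in $\mathbb{R}^n$ with the Euclidean norm $\|\cdot\|$, and $R_X:=2P_X-\mathrm{Id}$, $R_Y:=2P_Y-\mathrm{Id}$. For $z,v,w\in\mathbb{R}^n$, the circumcenter $\operatorname{circ}(z,v,w)$ is the point $p$ satisfying (i) $\|p-z\|=\|p-v\|=\|p-w\|$ and (ii) $p\in\operatorname{aff}\{z,v,w\}$. It exists and is unique if $\{z,v,w\}$ has cardinality one or two; when the three points are distinct, it exists (and is then unique) only if they are not collinear. The cCRM operator $T:\mathbb{R}^n\to\mathbb{R}^n$ is $T(z):=\operatorname{circ}(z_C,R_X(z_C),R_Y(z_C))$, where $z_C:=\frac12(z_{\mathrm{MAP}}+P_X(z_{\mathrm{MAP}}))$ and $z_{\mathrm{MAP}}:=P_YP_X(z)$. Differentiable manifold: the boundary of each set, intersected with a neighborhood of $\bar z$, is (if nonempty) an embedded manifold of dimension $n-1$, locally of the form $\{z\mid g(z)=0\}$ with $g:\mathbb{R}^n\to\mathbb{R}$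 of class $C^1$ and $\nabla g\neq0$ at the points considered. Superlinear convergence: a sequence $(w^k)$ converging to $\bar w$ with $w^k\ne\bar w$ for all $k$ converges superlinearly if $\lim_{k\to\infty}\|w^{k+1}-\bar w\|/\|w^k-\bar w\|=0$. If the cCRM sequence is finite, i.e. reaches $X\cap Y$ after finitely many steps (and then stays constant), superlinear convergence is regarded as holding trivially. *)

theory Defs
  imports "HOL-Analysis.Analysis"
begin

definition reflection :: "'a::euclidean_space set \<Rightarrow> 'a \<Rightarrow> 'a" where
  "reflection S z = 2 *\<^sub>R closest_point S z - z"

definition is_circumcenter :: "'a::euclidean_space \<Rightarrow> 'a \<Rightarrow> 'a \<Rightarrow> 'a \<Rightarrow> bool" where
  "is_circumcenter z v w p \<longleftrightarrow>
     norm (p - z) = norm (p - v) \<and> norm (p - v) = norm (p - w) \<and> p \<in> affine hull {z, v, w}"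

(* Unspecified when z, v, w are distinct and collinear: then no circumcenter exists.
   In all other cases it exists and is unique. *)
definition circ :: "'a::euclidean_space \<Rightarrow> 'a \<Rightarrow> 'a \<Rightarrow> 'a" where
  "circ z v w = (THE p. is_circumcenter z v w p)"

definition z_MAP :: "'a::euclidean_space set \<Rightarrow> 'a set \<Rightarrow> 'a \<Rightarrow> 'a" where
  "z_MAP X Y z = closest_point Y (closest_point X z)"

definition z_C :: "'a::euclidean_space set \<Rightarrow> 'a set \<Rightarrow> 'a \<Rightarrow> 'a" where
  "z_C X Y z = (1/2) *\<^sub>R (z_MAP X Y z + closest_point X (z_MAP X Y z))"

definition cCRM :: "'a::euclidean_space set \<Rightarrow> 'a set \<Rightarrow> 'a \<Rightarrow> 'a" where
  "cCRM X Y z = circ (z_C X Y z) (reflection X (z_C X Y z)) (reflection Y (z_C X Y z))"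

definition C1_function :: "('a::euclidean_space \<Rightarrow> real) \<Rightarrow> ('a \<Rightarrow> 'a) \<Rightarrow> bool" where
  "C1_function g grad \<longleftrightarrow> (\<forall>x. GDERIV g x :> grad x) \<and> continuous_on UNIV grad"

(* Embedded C^1 manifold of codimension 1, as a local zero set of a C^1 function with
   nonvanishing gradient along it.  The empty set qualifies. *)
definition C1_hypersurface :: "'a::euclidean_space set \<Rightarrow> bool" where
  "C1_hypersurface M \<longleftrightarrow>
     (\<forall>p\<in>M. \<exists>V g grad. open V \<and> p \<in> V \<and> C1_function g grad \<and>
        M \<inter> V = {x \<in> V. g x = 0} \<and> (\<forall>x \<in> M \<inter> V. grad x \<noteq> 0))"

definition boundary_differentiable_manifold_near :: "'a::euclidean_space set \<Rightarrow> 'a \<Rightarrow> bool" where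
  "boundary_differentiable_manifold_near S p \<longleftrightarrow>
     (\<exists>U. open U \<and> p \<in> U \<and> C1_hypersurface (frontier S \<inter> U))"

definition converges_superlinearly :: "(nat \<Rightarrow> 'a::real_normed_vector) \<Rightarrow> 'a \<Rightarrow> bool" where
  "converges_superlinearly w l \<longleftrightarrow>
     w \<longlonglongrightarrow> l \<and> (\<forall>k. w k \<noteq> l) \<and>
     (\<lambda>k. norm (w (Suc k) - l) / norm (w k - l)) \<longlonglongrightarrow> 0"

end

theory Submission
  imports Defs
begin

text \<open>
  Write \<open>T\<close> for the cCRM operator and \<open>zbar\<close> for the limit. Three facts combine.

  \<^item> Geometry of a step. The centralized point \<open>c = z_C X Y z\<close> sees \<open>X\<close> and \<open>Y\<close> under an obtuse angle,
    so the circumcenter \<open>T z\<close> is the projection of \<open>c\<close> onto the intersection of the two halfspaces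
    that support \<open>X\<close> and \<open>Y\<close> at the projections of \<open>c\<close> (a set containing \<open>c\<close> imposes no
    constraint). Hence \<open>T\<close> never moves away from a point of
    \<open>X \<inter> Y\<close> (\<open>dist_cCRM_le\<close>), and \<open>T z\<close>, unless it already solves the problem, lies in a supporting
    halfspace of \<open>X\<close> and in one of \<open>Y\<close>, with contact points at least as close to every point of \<open>X \<inter> Y\<close> as \<open>z\<close>
    (\<open>cCRM_supporting_halfspaces\<close>).

  \<^item> Smoothness. A \<open>C\<^sup>1\<close> boundary and nonempty interior allow at most one unit normal at \<open>zbar\<close>
    (\<open>unit_normal_unique\<close>). The normals form a closed graph over a compact sphere, so any two unit
    normals taken near \<open>zbar\<close> differ by at most \<open>\<epsilon>\<close> (\<open>unit_normals_nearly_agree\<close>). A point \<open>y\<close> of the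
    halfspace supporting the set at \<open>w\<close> is then within \<open>\<epsilon> * dist y w\<close> of the set
    (\<open>dist_closest_point_small_on_supporting_halfspace\<close>): a supporting halfspace agrees with the set
    to first order, just as a tangent line does in Newton's method.

  \<^item> Regularity. If \<open>X \<inter> Y\<close> contains a ball, the distance to \<open>X \<inter> Y\<close> is bounded by a multiple of the
    larger of the distances to \<open>X\<close> and \<open>Y\<close> (\<open>error_bound_interior\<close>), and Fejer monotonicity bounds
    the distance to the limit by twice the distance to \<open>X \<inter> Y\<close> (\<open>fejer_dist_limit_le\<close>).

  Together, if the iterates never reach \<open>X \<inter> Y\<close>, then \<open>z (Suc k)\<close> is within \<open>o(dist (z k) zbar)\<close> of both
  sets, hence of \<open>X \<inter> Y\<close>, hence of \<open>zbar\<close>. If some iterate reaches \<open>X \<inter> Y\<close>, it is a fixed point of \<open>T\<close>.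
\<close>

section \<open>Unit normals of sets with smooth boundary\<close>

definition unit_normal :: "'a::euclidean_space set \<Rightarrow> 'a \<Rightarrow> 'a \<Rightarrow> bool" where
  "unit_normal S w \<nu> \<longleftrightarrow> w \<in> S \<and> norm \<nu> = 1 \<and> (\<forall>x\<in>S. \<nu> \<bullet> (x - w) \<le> 0)"

lemma unit_normal_closest_point:
  assumes "closed S" "convex S" "S \<noteq> {}" "z \<notin> S"
  shows "unit_normal S (closest_point S z) (sgn (z - closest_point S z))"
proof -
  have "closest_point S z \<in> S"
    using assms by (simp add: closest_point_in_set)
  moreover from this have "z - closest_point S z \<noteq> 0"
    using assms(4) by auto
  moreover have "(z - closest_point S z) \<bullet> (x - closest_point S z) \<le> 0" if "x \<in> S" for x
    using closest_point_dot[OF assms(2,1) that] .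
  ultimately show ?thesis
    by (auto simp: unit_normal_def norm_sgn sgn_div_norm divide_simps mult_nonneg_nonpos)
qed

lemma unit_normal_in_frontier:
  assumes "unit_normal S w \<nu>"
  shows "w \<in> frontier S"
proof -
  have "w \<notin> interior S"
  proof
    assume "w \<in> interior S"
    then obtain e where e: "e > 0" "cball w e \<subseteq> S"
      by (auto simp: mem_interior_cball)
    have "w + e *\<^sub>R \<nu> \<in> S"
      using e assms by (auto simp: unit_normal_def dist_norm)
    then have "\<nu> \<bullet> (e *\<^sub>R \<nu>) \<le> 0"
      using assms by (force simp: unit_normal_def)
    moreover have "\<nu> \<bullet> \<nu> = 1"
      using assms by (simp add: unit_normal_def dot_square_norm)
    ultimately show False using e by simp
  qed
  then show ?thesis
    using assms closure_subset[of S] by (auto simp: unit_normal_def frontier_def)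
qed

text \<open>
  A direction \<open>d\<close> orthogonal to the gradient is tangent to the zero set of \<open>g\<close>: on the short segment
  through \<open>p + t *\<^sub>R d\<close> parallel to the gradient, with half-length proportional to \<open>\<eta> * t\<close> for an
  arbitrarily small \<open>\<eta>\<close>, the linear part of \<open>g\<close> at the ends is at least its remainder, so \<open>g\<close> changes sign and
  vanishes somewhere. This zero is a point of \<open>S\<close>, to which the normal inequality applies. The
  intermediate value theorem thus replaces the implicit function theorem.
\<close>

lemma unit_normal_nonpos_on_tangent_direction:
  fixes g :: "'a::euclidean_space \<Rightarrow> real"
  assumes V: "open V" "p \<in> V"
    and cont: "continuous_on V g"
    and deriv: "GDERIV g p :> G" "G \<noteq> 0" "g p = 0"
    and zeros: "\<And>x. x \<in> V \<Longrightarrow> g x = 0 \<Longrightarrow> x \<in> S"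
    and nu: "unit_normal S p \<nu>"
    and d: "d \<bullet> G = 0"
  shows "\<nu> \<bullet> d \<le> 0"
proof (rule field_le_epsilon)
  fix e :: real assume e: "e > 0"
  obtain \<rho> where \<rho>: "\<rho> > 0" "ball p \<rho> \<subseteq> V"
    using V openE by blast
  have G0: "norm G > 0" using deriv by simp
  \<comment> \<open>Slope of the thin cone around \<open>d\<close> in which a zero is sought; it makes the final error equal to \<open>e\<close>.\<close>
  define \<eta> where "\<eta> = e / norm G"
  have \<eta>: "\<eta> > 0" using e G0 by (simp add: \<eta>_def)
  define M where "M = norm d + \<eta> * norm G"
  have M: "M > 0" using \<eta> G0 by (simp add: M_def add_nonneg_pos)
  have "(g has_derivative (\<lambda>h. h \<bullet> G)) (at p)"
    using deriv by (simp add: gderiv_def)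
  \<comment> \<open>With this tolerance the remainder at distance \<open>t * M\<close> is at most \<open>\<eta> * t * (norm G)\<^sup>2\<close>, which is
      exactly the size of the linear part of \<open>g\<close> at the ends of the segment.\<close>
  moreover have "\<eta> * (norm G)\<^sup>2 / M > 0" using \<eta> G0 M by simp
  ultimately obtain \<delta> where \<delta>: "\<delta> > 0"
    and lin: "\<And>y. norm (y - p) < \<delta> \<Longrightarrow>
        norm (g y - g p - (y - p) \<bullet> G) \<le> \<eta> * (norm G)\<^sup>2 / M * norm (y - p)"
    unfolding has_derivative_at_alt by metis
  define t where "t = min \<rho> \<delta> / (2 * M)"
  have t: "t > 0" using \<rho> \<delta> M by (simp add: t_def)
  have tM: "t * M < \<rho>" "t * M < \<delta>"
    using \<rho> \<delta> M by (auto simp: t_def min_def)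
  define c where "c s = p + t *\<^sub>R d + s *\<^sub>R G" for s :: real
  have c_near: "norm (c s - p) \<le> t * M" if "\<bar>s\<bar> \<le> \<eta> * t" for s
  proof -
    have "norm (c s - p) \<le> norm (t *\<^sub>R d) + norm (s *\<^sub>R G)"
      unfolding c_def by (metis add.assoc add_diff_cancel_left' norm_triangle_ineq)
    also have "\<dots> \<le> t * norm d + (\<eta> * t) * norm G"
      using that t by (auto intro!: mult_right_mono)
    finally show ?thesis by (simp add: M_def algebra_simps)
  qed
  have c_val: "\<bar>g (c s) - s * (norm G)\<^sup>2\<bar> \<le> \<eta> * t * (norm G)\<^sup>2" if "\<bar>s\<bar> \<le> \<eta> * t" for s
  proof -
    have "(c s - p) \<bullet> G = s * (norm G)\<^sup>2"
      using d by (simp add: c_def algebra_simps dot_square_norm)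
    then have "\<bar>g (c s) - s * (norm G)\<^sup>2\<bar> \<le> \<eta> * (norm G)\<^sup>2 / M * norm (c s - p)"
      using lin[of "c s"] c_near[OF that] tM deriv by simp
    also have "\<dots> \<le> \<eta> * (norm G)\<^sup>2 / M * (t * M)"
      using c_near[OF that] \<eta> M by (intro mult_left_mono) auto
    finally show ?thesis using M by (simp add: mult_ac)
  qed
  have inV: "c s \<in> V" if "\<bar>s\<bar> \<le> \<eta> * t" for s
    using c_near[OF that] tM \<rho> by (auto simp: dist_norm norm_minus_commute subset_iff)
  have "\<exists>s. -(\<eta> * t) \<le> s \<and> s \<le> \<eta> * t \<and> g (c s) = 0"
  proof (rule IVT')
    show "g (c (-(\<eta> * t))) \<le> 0" using c_val[of "-(\<eta>*t)"] \<eta> t by (simp add: algebra_simps)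
    show "0 \<le> g (c (\<eta> * t))" using c_val[of "\<eta>*t"] \<eta> t by (simp add: algebra_simps)
    show "-(\<eta> * t) \<le> \<eta> * t" using \<eta> t by simp
    have "continuous_on {- (\<eta> * t)..\<eta> * t} c"
      unfolding c_def by (intro continuous_intros)
    then show "continuous_on {- (\<eta> * t)..\<eta> * t} (\<lambda>s. g (c s))"
      by (rule continuous_on_compose2[OF cont]) (auto intro!: inV)
  qed
  then obtain s where "- (\<eta> * t) \<le> s" "s \<le> \<eta> * t" and zero: "g (c s) = 0" by blast
  then have s: "\<bar>s\<bar> \<le> \<eta> * t" by simp
  from zero have "c s \<in> S" using zeros inV[OF s] by blast
  then have "\<nu> \<bullet> (t *\<^sub>R d + s *\<^sub>R G) \<le> 0"
    using nu unfolding unit_normal_def c_def by (metis add.assoc add_diff_cancel_left')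
  then have "t * (\<nu> \<bullet> d) \<le> - (s * (\<nu> \<bullet> G))" by (simp add: inner_add_right)
  also have "\<dots> \<le> \<bar>s\<bar> * \<bar>\<nu> \<bullet> G\<bar>" by (metis abs_ge_minus_self abs_mult)
  also have "\<dots> \<le> (\<eta> * t) * norm G"
    using s Cauchy_Schwarz_ineq2[of \<nu> G] nu \<eta> t
    by (intro mult_mono) (auto simp: unit_normal_def)
  also have "\<dots> = t * e" using G0 by (simp add: \<eta>_def)
  finally show "\<nu> \<bullet> d \<le> 0 + e" using t by simp
qed

text \<open>
  A unit normal is orthogonal to the tangent hyperplane, hence a multiple of the gradient, which leaves
  two candidates of opposite sign. If both were normals, the set would lie in a hyperplane, contradicting
  its nonempty interior.
\<close>

lemma unit_normal_unique:
  assumes "closed S" and int: "interior S \<noteq> {}"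
    and smooth: "boundary_differentiable_manifold_near S p"
    and nu: "unit_normal S p \<nu>" and nu': "unit_normal S p \<nu>'"
  shows "\<nu> = \<nu>'"
proof -
  have pF: "p \<in> frontier S" using nu by (rule unit_normal_in_frontier)
  obtain U where U: "open U" "p \<in> U" "C1_hypersurface (frontier S \<inter> U)"
    using smooth unfolding boundary_differentiable_manifold_near_def by blast
  have "p \<in> frontier S \<inter> U" using pF U by blast
  then obtain V g grad where V: "open V" "p \<in> V" and C1: "C1_function g grad"
    and eq: "frontier S \<inter> U \<inter> V = {x \<in> V. g x = 0}" and ne: "\<forall>x \<in> frontier S \<inter> U \<inter> V. grad x \<noteq> 0"
    using U(3) unfolding C1_hypersurface_def by meson
  define G where "G = grad p"
  have G: "GDERIV g p :> G" "G \<noteq> 0" "g p = 0"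
    using C1 ne eq pF U V by (auto simp: C1_function_def G_def)
  have cont: "continuous_on V g"
    using C1 unfolding C1_function_def gderiv_def
    by (meson continuous_at_imp_continuous_on has_derivative_continuous)
  have zeros: "x \<in> S" if "x \<in> V" "g x = 0" for x
    using that eq \<open>closed S\<close> by (auto simp: frontier_def)
  have along: "\<mu> = ((\<mu> \<bullet> G) / (G \<bullet> G)) *\<^sub>R G" if mu: "unit_normal S p \<mu>" for \<mu>
  proof -
    define d where "d = \<mu> - ((\<mu> \<bullet> G) / (G \<bullet> G)) *\<^sub>R G"
    have dG: "d \<bullet> G = 0" using G by (simp add: d_def inner_diff_left)
    have "\<mu> \<bullet> d \<le> 0"
      using unit_normal_nonpos_on_tangent_direction[OF V cont G zeros mu dG] by blast
    moreover have "d \<bullet> d = \<mu> \<bullet> d"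
      using dG by (simp add: d_def inner_diff_left inner_diff_right inner_commute)
    ultimately have "d = 0" by (metis inner_ge_zero inner_eq_zero_iff order_antisym)
    then show ?thesis by (simp add: d_def)
  qed
  define k where "k = (\<nu> \<bullet> G) / (G \<bullet> G)"
  define k' where "k' = (\<nu>' \<bullet> G) / (G \<bullet> G)"
  have k: "\<nu> = k *\<^sub>R G" "\<nu>' = k' *\<^sub>R G" using along nu nu' by (auto simp: k_def k'_def)
  have "\<bar>k\<bar> * norm G = \<bar>k'\<bar> * norm G"
    using nu nu' k by (metis norm_scaleR unit_normal_def)
  then have "\<bar>k\<bar> = \<bar>k'\<bar>" using G by simp
  then consider "\<nu>' = \<nu>" | "\<nu>' = - \<nu>" using k by (auto simp: abs_if split: if_splits)
  then show ?thesis
  proof cases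
    case 2
    have "\<nu> \<bullet> x = \<nu> \<bullet> p" if "x \<in> S" for x
      using nu nu' 2 that by (force simp: unit_normal_def inner_diff_right)
    then have "S \<subseteq> {x. \<nu> \<bullet> x = \<nu> \<bullet> p}" by blast
    then have "interior S \<subseteq> interior {x. \<nu> \<bullet> x = \<nu> \<bullet> p}" by (rule interior_mono)
    moreover have "\<nu> \<noteq> 0" using nu by (auto simp: unit_normal_def)
    ultimately show ?thesis using int interior_hyperplane by blast
  qed auto
qed

text \<open>
  Otherwise two sequences of unit normals at points tending to \<open>p\<close> stay apart; by compactness of
  the sphere they accumulate at two different unit vectors, and both are normals at \<open>p\<close> because the
  inequalities that define a normal pass to the limit. At an interior point \<open>p\<close> the uniqueness hypothesis
  holds vacuously, so that case needs no separate treatment.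
\<close>

lemma unit_normals_nearly_agree:
  fixes S :: "'a::euclidean_space set"
  assumes "closed S" and uniq: "\<And>\<nu> \<nu>'. unit_normal S p \<nu> \<Longrightarrow> unit_normal S p \<nu>' \<Longrightarrow> \<nu> = \<nu>'"
    and "e > 0"
  shows "\<exists>\<delta>>0. \<forall>w w' \<nu> \<nu>'. unit_normal S w \<nu> \<and> unit_normal S w' \<nu>' \<and> dist w p < \<delta> \<and> dist w' p < \<delta>
           \<longrightarrow> norm (\<nu> - \<nu>') \<le> e"
proof (rule ccontr)
  assume neg: "\<not> ?thesis"
  have "\<exists>w w' \<nu> \<nu>'. unit_normal S w \<nu> \<and> unit_normal S w' \<nu>' \<and> dist w p < inverse (real (Suc n))
      \<and> dist w' p < inverse (real (Suc n)) \<and> e < norm (\<nu> - \<nu>')" for n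
    using neg by (metis inverse_positive_iff_positive linorder_not_less of_nat_0_less_iff zero_less_Suc)
  then obtain w w' \<nu> \<nu>' where N: "\<And>n. unit_normal S (w n) (\<nu> n)" "\<And>n. unit_normal S (w' n) (\<nu>' n)"
    "\<And>n. dist (w n) p < inverse (real (Suc n))" "\<And>n. dist (w' n) p < inverse (real (Suc n))"
    "\<And>n. e < norm (\<nu> n - \<nu>' n)"
    by metis
  have lim: "w \<longlonglongrightarrow> p" "w' \<longlonglongrightarrow> p"
    using N by (auto intro!: metric_tendsto_imp_tendsto[OF LIMSEQ_inverse_real_of_nat] 
      eventuallyI less_imp_le simp: dist_real_def)
  have "compact (sphere (0::'a) 1 \<times> sphere (0::'a) 1)" by (intro compact_Times compact_sphere)
  moreover have "\<forall>n. (\<nu> n, \<nu>' n) \<in> sphere 0 1 \<times> sphere 0 1"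
    using N by (auto simp: unit_normal_def)
  ultimately obtain l r where r: "strict_mono (r::nat\<Rightarrow>nat)" and l: "((\<lambda>n. (\<nu> n, \<nu>' n)) \<circ> r) \<longlonglongrightarrow> l"
    unfolding compact_def by meson
  have closure: "unit_normal S p q"
    if A: "\<And>n. unit_normal S (a n) (m n)" and al: "a \<longlonglongrightarrow> p" and q: "(\<lambda>n. m (r n)) \<longlonglongrightarrow> q" for a m q
  proof -
    have ar: "(\<lambda>n. a (r n)) \<longlonglongrightarrow> p" using LIMSEQ_subseq_LIMSEQ[OF al r] by (simp add: o_def)
    have "p \<in> S" using closed_sequentially[OF \<open>closed S\<close> _ al] A by (auto simp: unit_normal_def)
    moreover have "norm q = 1"
      using LIMSEQ_unique[OF tendsto_norm[OF q]] A by (simp add: unit_normal_def)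
    moreover have "q \<bullet> (x - p) \<le> 0" if "x \<in> S" for x
    proof (rule LIMSEQ_le_const2)
      show "(\<lambda>n. m (r n) \<bullet> (x - a (r n))) \<longlonglongrightarrow> q \<bullet> (x - p)"
        by (intro tendsto_intros q ar)
      show "\<exists>N. \<forall>n\<ge>N. m (r n) \<bullet> (x - a (r n)) \<le> 0" using A that by (auto simp: unit_normal_def)
    qed
    ultimately show ?thesis by (simp add: unit_normal_def)
  qed
  have q: "(\<lambda>n. \<nu> (r n)) \<longlonglongrightarrow> fst l" "(\<lambda>n. \<nu>' (r n)) \<longlonglongrightarrow> snd l"
    using tendsto_fst[OF l] tendsto_snd[OF l] by (simp_all add: o_def)
  have "fst l = snd l"
    using uniq closure[OF N(1) lim(1) q(1)] closure[OF N(2) lim(2) q(2)] by blast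
  then have "(\<lambda>n. norm (\<nu> (r n) - \<nu>' (r n))) \<longlonglongrightarrow> 0"
    using tendsto_norm[OF tendsto_diff[OF q]] by simp
  then have "e \<le> 0" using N(5) by (intro LIMSEQ_le_const) (auto intro: less_imp_le)
  then show False using \<open>e > 0\<close> by simp
qed

text \<open>
  If \<open>x\<close> is the projection of \<open>y\<close> and \<open>\<mu>\<close> the unit normal pointing from \<open>x\<close> to \<open>y\<close>, then \<open>dist y x\<close> equals
  \<open>\<mu> \<bullet> (y - x)\<close>. The contact point \<open>w\<close> belongs to the set, so this is at most \<open>\<mu> \<bullet> (y - w)\<close>; since
  \<open>\<nu> \<bullet> (y - w) \<le> 0\<close>, only the small difference \<open>\<mu> - \<nu>\<close> of two nearby normals contributes.
\<close>

lemma dist_closest_point_small_on_supporting_halfspace: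
  fixes S :: "'a::euclidean_space set"
  assumes S: "closed S" "convex S" "interior S \<noteq> {}" "p \<in> S"
    and smooth: "boundary_differentiable_manifold_near S p" and e: "e > 0"
  shows "\<exists>\<delta>>0. \<forall>y w \<nu>. dist y p < \<delta> \<and> dist w p < \<delta> \<and> unit_normal S w \<nu> \<and> \<nu> \<bullet> (y - w) \<le> 0
           \<longrightarrow> dist y (closest_point S y) \<le> e * dist y w"
proof -
  obtain \<delta> where \<delta>: "\<delta> > 0" and agree: "\<And>w w' \<nu> \<nu>'. unit_normal S w \<nu> \<Longrightarrow> unit_normal S w' \<nu>'
      \<Longrightarrow> dist w p < \<delta> \<Longrightarrow> dist w' p < \<delta> \<Longrightarrow> norm (\<nu> - \<nu>') \<le> e"
    using unit_normals_nearly_agree[OF S(1) unit_normal_unique[OF S(1,3) smooth] e] by metis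
  have "dist y (closest_point S y) \<le> e * dist y w"
    if y: "dist y p < \<delta>" and w: "dist w p < \<delta>" and nu: "unit_normal S w \<nu>" "\<nu> \<bullet> (y - w) \<le> 0" for y w \<nu>
  proof (cases "y \<in> S")
    case True
    then show ?thesis using e by (simp add: closest_point_self)
  next
    case False
    define x where "x = closest_point S y"
    define \<mu> where "\<mu> = sgn (y - x)"
    have mu: "unit_normal S x \<mu>"
      unfolding x_def \<mu>_def using S(4) by (auto intro: unit_normal_closest_point[OF S(1,2) _ False])
    have "dist x p \<le> dist y p"
      using closest_point_lipschitz[OF S(2,1), of y p] S(4) by (auto simp: x_def closest_point_self)
    then have agr: "norm (\<mu> - \<nu>) \<le> e" using agree[OF mu nu(1)] y w by simp
    have "dist y x = \<mu> \<bullet> (y - x)"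
      by (simp add: \<mu>_def sgn_div_norm dist_norm dot_square_norm power2_eq_square divide_simps)
    also have "\<dots> = \<mu> \<bullet> (y - w) + \<mu> \<bullet> (w - x)" by (simp add: algebra_simps)
    also have "\<dots> \<le> \<mu> \<bullet> (y - w)" using mu nu(1) by (simp add: unit_normal_def)
    also have "\<dots> \<le> (\<mu> - \<nu>) \<bullet> (y - w)" using nu(2) by (simp add: inner_diff_left)
    also have "\<dots> \<le> norm (\<mu> - \<nu>) * norm (y - w)" by (rule norm_cauchy_schwarz)
    also have "\<dots> \<le> e * dist y w" using agr by (simp add: dist_norm mult_right_mono)
    finally show ?thesis by (simp add: x_def)
  qed
  then show ?thesis using \<delta> by blast
qed

section \<open>The circumcenter step\<close>

text \<open>
  For the reflected points \<open>c - 2 *\<^sub>R a\<close> and \<open>c - 2 *\<^sub>R b\<close>, the perpendicular bisectors towards \<open>c\<close> are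
  hyperplanes through the projections \<open>c - a\<close> and \<open>c - b\<close>, so equidistance becomes two linear equations.
  A difference of two solutions in the affine hull is both spanned by and orthogonal to \<open>a\<close> and \<open>b\<close>.
  Coincident points are covered, as \<open>a\<close> or \<open>b\<close> may be zero.
\<close>

lemma circ_eqI:
  assumes p: "p = c - \<alpha> *\<^sub>R a - \<beta> *\<^sub>R b" and pa: "(p - c) \<bullet> a = - (a \<bullet> a)" and pb: "(p - c) \<bullet> b = - (b \<bullet> b)"
  shows "circ c (c - 2 *\<^sub>R a) (c - 2 *\<^sub>R b) = p"
proof -
  have eqd: "norm (q - c) = norm (q - (c - 2 *\<^sub>R d)) \<longleftrightarrow> (q - c) \<bullet> d = - (d \<bullet> d)" for q d :: 'a
  proof -
    have "q - (c - 2 *\<^sub>R d) = (q - c) + 2 *\<^sub>R d" by simp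
    then show ?thesis
      by (simp only: norm_eq) (auto simp: inner_add_left inner_add_right inner_commute)
  qed
  have aff: "q \<in> affine hull {c, c - 2 *\<^sub>R a, c - 2 *\<^sub>R b} \<longleftrightarrow> (\<exists>u v. q = c - u *\<^sub>R a - v *\<^sub>R b)" for q
  proof
    assume "q \<in> affine hull {c, c - 2 *\<^sub>R a, c - 2 *\<^sub>R b}"
    then obtain t u v where "t + u + v = 1" "q = t *\<^sub>R c + u *\<^sub>R (c - 2 *\<^sub>R a) + v *\<^sub>R (c - 2 *\<^sub>R b)"
      unfolding affine_hull_3 by auto
    moreover have "t = 1 - u - v" using calculation(1) by simp
    ultimately have "q = c - (2 * u) *\<^sub>R a - (2 * v) *\<^sub>R b" by (simp add: algebra_simps)
    then show "\<exists>u v. q = c - u *\<^sub>R a - v *\<^sub>R b" by blast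
  next
    assume "\<exists>u v. q = c - u *\<^sub>R a - v *\<^sub>R b"
    then obtain u v where "q = c - u *\<^sub>R a - v *\<^sub>R b" by blast
    then have "q = (1 - u/2 - v/2) *\<^sub>R c + (u/2) *\<^sub>R (c - 2 *\<^sub>R a) + (v/2) *\<^sub>R (c - 2 *\<^sub>R b)"
      by (simp add: algebra_simps)
    moreover have "(1 - u/2 - v/2) + u/2 + v/2 = 1" by simp
    ultimately show "q \<in> affine hull {c, c - 2 *\<^sub>R a, c - 2 *\<^sub>R b}"
      unfolding affine_hull_3 by blast
  qed
  have char: "is_circumcenter c (c - 2 *\<^sub>R a) (c - 2 *\<^sub>R b) q \<longleftrightarrow>
     (q - c) \<bullet> a = - (a \<bullet> a) \<and> (q - c) \<bullet> b = - (b \<bullet> b) \<and> (\<exists>u v. q = c - u *\<^sub>R a - v *\<^sub>R b)" for q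
    unfolding is_circumcenter_def aff using eqd[of q a] eqd[of q b] by metis
  show ?thesis unfolding circ_def
  proof (rule the_equality)
    show "is_circumcenter c (c - 2 *\<^sub>R a) (c - 2 *\<^sub>R b) p" using char p pa pb by blast
    fix q assume "is_circumcenter c (c - 2 *\<^sub>R a) (c - 2 *\<^sub>R b) q"
    then obtain u v where q: "(q - c) \<bullet> a = - (a \<bullet> a)" "(q - c) \<bullet> b = - (b \<bullet> b)" "q = c - u *\<^sub>R a - v *\<^sub>R b"
      using char by blast
    have "(q - p) \<bullet> a = 0" "(q - p) \<bullet> b = 0"
      using q(1,2) pa pb by (simp_all add: inner_diff_left)
    moreover have "q - p = (\<alpha> - u) *\<^sub>R a + (\<beta> - v) *\<^sub>R b"
      using p q(3) by (simp add: algebra_simps)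
    ultimately have "(q - p) \<bullet> (q - p) = 0"
      by (metis add.right_neutral inner_add_right inner_scaleR_right mult_zero_right)
    then show "q = p" by simp
  qed
qed

text \<open>
  The circumcenter is \<open>c - \<alpha> *\<^sub>R a - \<beta> *\<^sub>R b\<close> with \<open>\<alpha>\<close>, \<open>\<beta>\<close> solving a \<open>2 \<times> 2\<close> system whose matrix is the Gram
  matrix of \<open>a\<close> and \<open>b\<close>. The obtuse angle makes \<open>\<alpha>\<close> and \<open>\<beta>\<close> nonnegative, which are the Karush-Kuhn-Tucker
  conditions for \<open>p\<close> to be the projection of \<open>c\<close> onto the intersection of the two halfspaces containing
  \<open>s\<close>; so \<open>p\<close> is at least as close to \<open>s\<close> as \<open>c\<close>. The point \<open>s\<close> also rules out that \<open>a\<close> and \<open>b\<close> are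
  antiparallel, the collinear situation without circumcenter.
\<close>

lemma circ_of_obtuse_displacements:
  fixes a b c :: "'a::euclidean_space"
  assumes ab: "a \<bullet> b \<le> - (b \<bullet> b)"
    and s: "(s - c) \<bullet> a \<le> - (a \<bullet> a)" "(s - c) \<bullet> b \<le> - (b \<bullet> b)"
  defines "p \<equiv> circ c (c - 2 *\<^sub>R a) (c - 2 *\<^sub>R b)"
  shows "(p - c) \<bullet> a = - (a \<bullet> a)" "(p - c) \<bullet> b = - (b \<bullet> b)" "dist p s \<le> dist c s"
    "b = 0 \<Longrightarrow> p = c - a"
proof -
  have b0: "b = 0" if "a = 0"
  proof -
    have "b \<bullet> b \<le> 0" using ab that by simp
    then show ?thesis using inner_gt_zero_iff[of b] by linarith
  qed
  define D where "D = (a \<bullet> a) * (b \<bullet> b) - (a \<bullet> b)\<^sup>2"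
  \<comment> \<open>Cramer's rule; for \<open>b = 0\<close> the system is singular and the circumcenter is the midpoint \<open>c - a\<close>.\<close>
  define \<alpha> where "\<alpha> = (if b = 0 then 1 else ((a \<bullet> a) * (b \<bullet> b) - (b \<bullet> b) * (a \<bullet> b)) / D)"
  define \<beta> where "\<beta> = (if b = 0 then 0 else ((a \<bullet> a) * (b \<bullet> b) - (a \<bullet> a) * (a \<bullet> b)) / D)"
  have D: "D > 0" if "b \<noteq> 0"
  proof -
    have bb: "b \<bullet> b > 0" using that by simp
    have "D \<ge> 0" using Cauchy_Schwarz_ineq[of a b] by (simp add: D_def)
    moreover have "D \<noteq> 0"
    proof
      assume D0: "D = 0"
      \<comment> \<open>\<open>h\<close> is a multiple of the component of \<open>a\<close> orthogonal to \<open>b\<close>.\<close>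
      define h where "h = (b \<bullet> b) *\<^sub>R a - (a \<bullet> b) *\<^sub>R b"
      have "h \<bullet> h = (b \<bullet> b) * D"
        by (simp add: h_def D_def inner_diff_left inner_diff_right inner_commute power2_eq_square algebra_simps)
      then have "h = 0" using D0 by simp
      then have par: "(b \<bullet> b) *\<^sub>R a = (a \<bullet> b) *\<^sub>R b" by (simp add: h_def)
      have a0: "a \<noteq> 0" using b0 that by blast
      have "(b \<bullet> b) * ((s - c) \<bullet> a) = (a \<bullet> b) * ((s - c) \<bullet> b)"
        using par by (metis inner_scaleR_right)
      moreover have "(a \<bullet> b) * ((s - c) \<bullet> b) \<ge> 0"
        using ab s(2) bb by (intro mult_nonpos_nonpos) linarith+
      moreover have "(b \<bullet> b) * ((s - c) \<bullet> a) < 0"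
      proof -
        have "a \<bullet> a > 0" using a0 by simp
        then show ?thesis using s(1) bb by (intro mult_pos_neg) linarith+
      qed
      ultimately show False by simp
    qed
    ultimately show ?thesis by simp
  qed
  have ab0: "a \<bullet> b \<le> 0" using ab inner_ge_zero[of b] by linarith
  have nonneg: "\<alpha> \<ge> 0" "\<beta> \<ge> 0"
  proof -
    have "(b \<bullet> b) * (a \<bullet> b) \<le> 0" "(a \<bullet> a) * (a \<bullet> b) \<le> 0" "(a \<bullet> a) * (b \<bullet> b) \<ge> 0"
      using ab0 by (simp_all add: mult_nonneg_nonpos)
    then have "0 \<le> (a \<bullet> a) * (b \<bullet> b) - (b \<bullet> b) * (a \<bullet> b)" "0 \<le> (a \<bullet> a) * (b \<bullet> b) - (a \<bullet> a) * (a \<bullet> b)"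
      by linarith+
    then show "\<alpha> \<ge> 0" "\<beta> \<ge> 0"
      using D order_less_imp_le[of 0 D] by (auto simp: \<alpha>_def \<beta>_def intro: divide_nonneg_nonneg)
  qed
  define q where "q = c - \<alpha> *\<^sub>R a - \<beta> *\<^sub>R b"
  have lin: "\<alpha> * (a \<bullet> a) + \<beta> * (a \<bullet> b) = a \<bullet> a \<and> \<alpha> * (a \<bullet> b) + \<beta> * (b \<bullet> b) = b \<bullet> b"
  proof (cases "b = 0")
    case False
    have D0: "D \<noteq> 0" using D[OF False] by simp
    have "((a \<bullet> a) * (b \<bullet> b) - (b \<bullet> b) * (a \<bullet> b)) * (a \<bullet> a)
         + ((a \<bullet> a) * (b \<bullet> b) - (a \<bullet> a) * (a \<bullet> b)) * (a \<bullet> b) = (a \<bullet> a) * D"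
      "((a \<bullet> a) * (b \<bullet> b) - (b \<bullet> b) * (a \<bullet> b)) * (a \<bullet> b)
         + ((a \<bullet> a) * (b \<bullet> b) - (a \<bullet> a) * (a \<bullet> b)) * (b \<bullet> b) = (b \<bullet> b) * D"
      by (simp_all add: D_def algebra_simps power2_eq_square)
    then show ?thesis using D0 False
      by (simp add: \<alpha>_def \<beta>_def add_divide_distrib[symmetric] divide_eq_eq)
  qed (simp add: \<alpha>_def \<beta>_def)
  have "(q - c) \<bullet> a = - (\<alpha> * (a \<bullet> a) + \<beta> * (a \<bullet> b))" "(q - c) \<bullet> b = - (\<alpha> * (a \<bullet> b) + \<beta> * (b \<bullet> b))"
    by (simp_all add: q_def inner_diff_left inner_diff_right inner_commute)
  then have qa: "(q - c) \<bullet> a = - (a \<bullet> a)" and qb: "(q - c) \<bullet> b = - (b \<bullet> b)"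
    using lin by simp_all
  have pq: "p = q" unfolding p_def by (rule circ_eqI[OF q_def qa qb])
  show "(p - c) \<bullet> a = - (a \<bullet> a)" "(p - c) \<bullet> b = - (b \<bullet> b)" using pq qa qb by auto
  show "b = 0 \<Longrightarrow> p = c - a" by (simp add: pq q_def \<alpha>_def \<beta>_def)
  have "(q - s) \<bullet> a \<ge> 0" "(q - s) \<bullet> b \<ge> 0" using qa qb s by (simp_all add: inner_diff_left)
  then have "(q - s) \<bullet> (c - q) \<ge> 0"
    using nonneg by (simp add: q_def inner_add_right inner_diff_right)
  then have "(q - s) \<bullet> (q - s) \<le> (c - s) \<bullet> (c - s)"
    using inner_ge_zero[of "c - q"]
    by (simp add: inner_diff_left inner_diff_right inner_commute)
  then show "dist p s \<le> dist c s" by (simp add: pq dist_norm norm_le)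
qed

lemma closest_point_eqI:
  assumes "closed S" "convex S" "w \<in> S" "\<And>x. x \<in> S \<Longrightarrow> (z - w) \<bullet> (x - w) \<le> 0"
  shows "closest_point S z = w"
proof -
  define q where "q = closest_point S z"
  have qS: "q \<in> S" using assms(1,3) by (auto simp: q_def intro: closest_point_in_set)
  have "(z - q) \<bullet> (w - q) \<le> 0" "(z - w) \<bullet> (q - w) \<le> 0"
    using closest_point_dot[OF assms(2,1,3), of z] assms(4)[OF qS] by (auto simp: q_def)
  then have "(q - w) \<bullet> (q - w) \<le> 0"
    by (simp add: inner_diff_left inner_diff_right inner_commute)
  then have "q - w = 0" using inner_gt_zero_iff[of "q - w"] by linarith
  then show ?thesis by (simp add: q_def)
qed

lemma dist_closest_point_le:
  assumes "closed S" "convex S" "s \<in> S"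
  shows "dist (closest_point S z) s \<le> dist z s"
  using closest_point_lipschitz[OF assms(2,1), of z s] assms(3) closest_point_self by fastforce

lemma inner_sgn_nonpos:
  "a \<bullet> x \<le> 0 \<Longrightarrow> sgn a \<bullet> x \<le> 0" for a x :: "'a::real_inner"
  by (simp add: sgn_div_norm mult_nonneg_nonpos)

lemma reflection_eq: "reflection S c = c - 2 *\<^sub>R (c - closest_point S c)"
  by (simp add: reflection_def algebra_simps scaleR_2)

text \<open>
  Let \<open>m\<close> be the point \<open>z_MAP X Y z\<close>, \<open>w\<close> its projection onto \<open>X\<close> and \<open>c\<close> the midpoint of \<open>m\<close> and \<open>w\<close>.
  Then \<open>c\<close> also projects to \<open>w\<close>, and because \<open>m \<in> Y\<close> the projection of \<open>c\<close> onto \<open>Y\<close> lies on the side of \<open>m\<close>: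
  this is the obtuse angle.

  The delicate case is \<open>c \<in> Y\<close>, where \<open>c\<close> determines no normal of \<open>Y\<close> and the circumcenter is \<open>w\<close>, possibly
  outside \<open>Y\<close>. The halfspace for \<open>Y\<close> then comes from the earlier projection of \<open>u = closest_point X z\<close>
  to \<open>m\<close>: it contains \<open>c\<close>, and its boundary passes through \<open>m\<close>, so it contains the whole ray from \<open>m\<close>
  through \<open>c\<close>, in particular \<open>w\<close>.
\<close>

lemma
  fixes X Y :: "'a::euclidean_space set"
  assumes X: "closed X" "convex X" and Y: "closed Y" "convex Y"
  shows cCRM_fixed: "z \<in> X \<inter> Y \<Longrightarrow> cCRM X Y z = z"
    and dist_cCRM_le: "s \<in> X \<inter> Y \<Longrightarrow> dist (cCRM X Y z) s \<le> dist z s"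
    and cCRM_supporting_halfspaces: "X \<inter> Y \<noteq> {} \<Longrightarrow> cCRM X Y z \<notin> X \<inter> Y \<Longrightarrow>
      \<exists>u v \<mu> \<nu>. unit_normal X u \<mu> \<and> unit_normal Y v \<nu> \<and>
        \<mu> \<bullet> (cCRM X Y z - u) \<le> 0 \<and> \<nu> \<bullet> (cCRM X Y z - v) \<le> 0 \<and>
        (\<forall>s \<in> X \<inter> Y. dist u s \<le> dist z s \<and> dist v s \<le> dist z s)"
proof -
  define m where "m = z_MAP X Y z"
  define w where "w = closest_point X m"
  define c where "c = z_C X Y z"
  define v where "v = closest_point Y c"
  define p where "p = cCRM X Y z"
  have c_mid: "c = (1/2) *\<^sub>R (m + w)" by (simp add: c_def z_C_def m_def w_def)
  show fixed: "cCRM X Y z = z" if "z \<in> X \<inter> Y"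
  proof -
    have "m = z" using that by (simp add: m_def z_MAP_def closest_point_self)
    then have "c = z" using that by (simp add: c_mid w_def closest_point_self flip: scaleR_2)
    then show ?thesis
      using that circ_eqI[of z z 0 0 0 0]
      by (simp add: cCRM_def c_def[symmetric] reflection_eq closest_point_self)
  qed
  \<comment> \<open>One statement for both remaining claims: each needs the obtuse angle and a point \<open>s\<close> of \<open>X \<inter> Y\<close>.\<close>
  have main: "dist p s \<le> dist z s \<and> (p \<in> X \<inter> Y \<or>
      (\<exists>u v \<mu> \<nu>. unit_normal X u \<mu> \<and> unit_normal Y v \<nu> \<and>
        \<mu> \<bullet> (p - u) \<le> 0 \<and> \<nu> \<bullet> (p - v) \<le> 0 \<and>
        (\<forall>s \<in> X \<inter> Y. dist u s \<le> dist z s \<and> dist v s \<le> dist z s)))" if s: "s \<in> X \<inter> Y" for s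
  proof -
    have ne: "X \<noteq> {}" "Y \<noteq> {}" using s by auto
    have wX: "w \<in> X" and mY: "m \<in> Y" and vY: "v \<in> Y"
      using ne X Y by (auto simp: w_def m_def z_MAP_def v_def closest_point_in_set)
    have dm: "dist m s \<le> dist z s" if "s \<in> X \<inter> Y" for s
      using that dist_closest_point_le[OF X, of s z] dist_closest_point_le[OF Y, of s "closest_point X z"]
      by (auto simp: m_def z_MAP_def)
    have dw: "dist w s \<le> dist z s" if "s \<in> X \<inter> Y" for s
      using that dist_closest_point_le[OF X, of s m] dm[OF that] by (auto simp: w_def)
    have dc: "dist c s \<le> dist z s" if "s \<in> X \<inter> Y" for s
    proof -
      have "c \<in> cball s (dist z s)"
        using convexD[OF convex_cball, of m s "dist z s" w "1/2" "1/2"] dm[OF that] dw[OF that]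
        by (simp add: c_mid dist_commute scaleR_add_right)
      then show ?thesis by (simp add: dist_commute)
    qed
    have dv: "dist v s \<le> dist z s" if "s \<in> X \<inter> Y" for s
      using that dist_closest_point_le[OF Y, of s c] dc[OF that] by (auto simp: v_def)
    have cw: "c - w = (1/2) *\<^sub>R (m - w)" and mc: "m - c = c - w"
      by (simp_all add: c_mid algebra_simps flip: scaleR_2)
    have Pc: "closest_point X c = w"
    proof (rule closest_point_eqI[OF X wX])
      fix x assume "x \<in> X"
      then have "(m - w) \<bullet> (x - w) \<le> 0" using closest_point_dot[OF X(2,1)] by (simp add: w_def)
      then show "(c - w) \<bullet> (x - w) \<le> 0" by (simp add: cw)
    qed
    define a where "a = c - w"
    define b where "b = c - v"
    have p_circ: "p = circ c (c - 2 *\<^sub>R a) (c - 2 *\<^sub>R b)"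
      by (simp add: p_def cCRM_def c_def[symmetric] reflection_eq Pc v_def[symmetric] a_def b_def)
    have "b \<bullet> (m - v) \<le> 0"
      using closest_point_dot[OF Y(2,1) mY] by (simp add: b_def v_def)
    moreover have "m - v = a + b" using mc by (simp add: a_def b_def algebra_simps)
    ultimately have ab: "a \<bullet> b \<le> - (b \<bullet> b)" by (simp add: inner_add_right inner_commute)
    have "a \<bullet> (s - w) \<le> 0" "b \<bullet> (s - v) \<le> 0"
      using closest_point_dot[OF X(2,1), of s c] closest_point_dot[OF Y(2,1), of s c] s
      by (auto simp: a_def b_def Pc v_def)
    then have sa: "(s - c) \<bullet> a \<le> - (a \<bullet> a)" and sb: "(s - c) \<bullet> b \<le> - (b \<bullet> b)"
      by (simp_all add: a_def b_def inner_diff_left inner_diff_right inner_commute)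
    note circ = circ_of_obtuse_displacements[OF ab sa sb, folded p_circ]
    have pw: "a \<bullet> (p - w) = 0" and pv: "b \<bullet> (p - v) = 0"
      using circ(1,2) by (simp_all add: a_def b_def inner_diff_left inner_diff_right inner_commute)
    have "dist p s \<le> dist z s" using circ(3) dc[OF s] by simp
    moreover have "\<exists>u v \<mu> \<nu>. unit_normal X u \<mu> \<and> unit_normal Y v \<nu> \<and>
        \<mu> \<bullet> (p - u) \<le> 0 \<and> \<nu> \<bullet> (p - v) \<le> 0 \<and>
        (\<forall>s \<in> X \<inter> Y. dist u s \<le> dist z s \<and> dist v s \<le> dist z s)" if pXY: "p \<notin> X \<inter> Y"
    proof -
      have cX: "c \<notin> X"
      proof
        assume "c \<in> X"
        then have cw': "c = w" using Pc by (simp add: closest_point_self)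
        then have "c = m" using mc by simp
        then have "c \<in> X \<inter> Y" using cw' wX mY by simp
        then have "a = 0" "b = 0" by (auto simp: a_def b_def v_def cw'[symmetric] closest_point_self)
        then have "p = c" using circ(4) by simp
        then show False using pXY \<open>c \<in> X \<inter> Y\<close> by simp
      qed
      have nX: "unit_normal X w (sgn a)"
        using unit_normal_closest_point[OF X ne(1) cX] by (simp add: Pc a_def)
      have hX: "sgn a \<bullet> (p - w) \<le> 0" using pw by (intro inner_sgn_nonpos) simp
      show ?thesis
      proof (cases "c \<in> Y")
        case False
        then have nY: "unit_normal Y v (sgn b)"
          using unit_normal_closest_point[OF Y ne(2)] by (simp add: v_def b_def)
        have hY: "sgn b \<bullet> (p - v) \<le> 0" using pv by (intro inner_sgn_nonpos) simp
        show ?thesis using nX hX nY hY dw dv by blast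
      next
        case True
        then have "b = 0" by (simp add: b_def v_def closest_point_self)
        then have "p = w" using circ(4) by (simp add: a_def)
        define u where "u = closest_point X z"
        have uX: "u \<in> X" using ne X by (simp add: u_def closest_point_in_set)
        have mu: "m = closest_point Y u" by (simp add: m_def z_MAP_def u_def)
        have "u \<notin> Y"
        proof
          assume "u \<in> Y"
          then have "m = u" by (simp add: mu closest_point_self)
          then have "w = m" using uX by (simp add: w_def closest_point_self)
          then show False using pXY \<open>p = w\<close> wX mY by simp
        qed
        then have nY: "unit_normal Y m (sgn (u - m))"
          using unit_normal_closest_point[OF Y ne(2)] by (simp add: mu)
        have "sgn (u - m) \<bullet> (c - m) \<le> 0" using nY True by (simp add: unit_normal_def)
        moreover have "p - m = 2 *\<^sub>R (c - m)"
          by (simp add: \<open>p = w\<close> c_mid algebra_simps flip: scaleR_2)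
        ultimately have hY: "sgn (u - m) \<bullet> (p - m) \<le> 0" by simp
        show ?thesis using nX hX nY hY dw dm by blast
      qed
    qed
    ultimately show ?thesis by blast
  qed
  show "s \<in> X \<inter> Y \<Longrightarrow> dist (cCRM X Y z) s \<le> dist z s" using main p_def by blast
  show "X \<inter> Y \<noteq> {} \<Longrightarrow> cCRM X Y z \<notin> X \<inter> Y \<Longrightarrow>
      \<exists>u v \<mu> \<nu>. unit_normal X u \<mu> \<and> unit_normal Y v \<nu> \<and>
        \<mu> \<bullet> (cCRM X Y z - u) \<le> 0 \<and> \<nu> \<bullet> (cCRM X Y z - v) \<le> 0 \<and>
        (\<forall>s \<in> X \<inter> Y. dist u s \<le> dist z s \<and> dist v s \<le> dist z s)"
    using main unfolding p_def by blast
qed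

section \<open>Error bound under an interior point, and Fejer monotonicity\<close>

text \<open>
  The convex combination of \<open>y\<close> and \<open>s\<close> is also a combination, with the same weights, of \<open>x \<in> S\<close>
  and of the point \<open>s + (r / d) *\<^sub>R (y - x)\<close> of the ball. The combination depends on the set only
  through \<open>r\<close> and \<open>d\<close>, so one point serves several sets at once.
\<close>

lemma pull_towards_ball_in_convex:
  fixes S :: "'a::real_normed_vector set"
  assumes "convex S" "cball s r \<subseteq> S" "x \<in> S" "r > 0" "dist y x \<le> d"
  shows "(r / (r + d)) *\<^sub>R y + (d / (r + d)) *\<^sub>R s \<in> S"
proof (cases "d = 0")
  case True
  then show ?thesis using assms by simp
next
  case False
  then have d: "d > 0" using assms(5) zero_le_dist[of y x] by linarith
  define b where "b = s + (r / d) *\<^sub>R (y - x)"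
  have "norm (y - x) * r \<le> d * r" using assms(4,5) by (simp add: dist_norm)
  then have "norm ((r / d) *\<^sub>R (y - x)) \<le> r"
    using d assms(4) by (simp add: divide_simps mult.commute)
  then have "b \<in> S" using assms(2) by (auto simp: b_def dist_norm)
  then have "(r / (r + d)) *\<^sub>R x + (d / (r + d)) *\<^sub>R b \<in> S"
    using assms d by (intro convexD) (auto simp: add_divide_distrib[symmetric])
  moreover have "(r / (r + d)) *\<^sub>R x + (d / (r + d)) *\<^sub>R b = (r / (r + d)) *\<^sub>R y + (d / (r + d)) *\<^sub>R s"
    using d by (simp add: b_def algebra_simps)
  ultimately show ?thesis by simp
qed

lemma error_bound_interior:
  fixes X Y :: "'a::real_normed_vector set"
  assumes "convex X" "convex Y" "cball s r \<subseteq> X \<inter> Y" "r > 0"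
    "x \<in> X" "dist y x \<le> d" "x' \<in> Y" "dist y x' \<le> d"
  shows "\<exists>q \<in> X \<inter> Y. dist y q \<le> d / r * dist y s"
proof
  let ?q = "(r / (r + d)) *\<^sub>R y + (d / (r + d)) *\<^sub>R s"
  have d: "d \<ge> 0" using assms(6) zero_le_dist[of y x] by linarith
  show "?q \<in> X \<inter> Y"
    using pull_towards_ball_in_convex[OF assms(1) _ assms(5,4,6)]
      pull_towards_ball_in_convex[OF assms(2) _ assms(7,4,8)] assms(3) by blast
  have "y = (r / (r + d)) *\<^sub>R y + (d / (r + d)) *\<^sub>R y"
    using d assms(4) by (simp add: scaleR_add_left[symmetric] add_divide_distrib[symmetric])
  then have "y - ?q = (d / (r + d)) *\<^sub>R (y - s)"
    by (metis add_diff_cancel_left scaleR_diff_right)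
  then have "dist y ?q = d / (r + d) * dist y s"
    using d assms(4) by (simp add: dist_norm)
  also have "\<dots> \<le> d / r * dist y s"
    using d assms(4) by (intro mult_right_mono divide_left_mono) auto
  finally show "dist y ?q \<le> d / r * dist y s" .
qed

text \<open>
  The limit \<open>l\<close> is at most as far from \<open>q\<close> as \<open>z k\<close> is, and the triangle inequality through \<open>q\<close> gives the
  factor 2.
\<close>

lemma fejer_dist_limit_le:
  fixes z :: "nat \<Rightarrow> 'a::metric_space"
  assumes fejer: "\<And>k. dist (z (Suc k)) q \<le> dist (z k) q" and "z \<longlonglongrightarrow> l"
  shows "dist (z k) l \<le> 2 * dist (z k) q"
proof -
  have "dist (z j) q \<le> dist (z k) q" if "j \<ge> k" for j
    using that fejer by (rule lift_Suc_antimono_le[where f = "\<lambda>k. dist (z k) q", rotated])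
  then have "dist l q \<le> dist (z k) q"
    by (intro LIMSEQ_le_const2[OF tendsto_dist[OF assms(2) tendsto_const]]) auto
  then show ?thesis using dist_triangle2[of "z k" l q] by simp
qed

section \<open>Superlinear convergence\<close>

theorem theorem3p13:
  fixes X Y :: "(real ^ 'n) set"
    and z :: "nat \<Rightarrow> real ^ 'n"
    and zbar :: "real ^ 'n"
  assumes "closed X" and "convex X"
    and "closed Y" and "convex Y"
    and "X \<inter> Y \<noteq> {}"
    and "\<And>k. z (Suc k) = cCRM X Y (z k)"
    and "z \<longlonglongrightarrow> zbar"
    and "zbar \<in> X \<inter> Y"
    and "interior (X \<inter> Y) \<noteq> {}"
    and "boundary_differentiable_manifold_near X zbar"
    and "boundary_differentiable_manifold_near Y zbar"
  shows "(\<exists>K. z K \<in> X \<inter> Y \<and> (\<forall>k\<ge>K. z k = z K)) \<or> converges_superlinearly z zbar"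
proof (cases "\<exists>K. z K \<in> X \<inter> Y")
  case True
  then obtain K where K: "z K \<in> X \<inter> Y" by blast
  have "z k = z K" if "k \<ge> K" for k
    using that
  proof (induction k rule: dec_induct)
    case (step n)
    then show ?case using assms(6)[of n] cCRM_fixed[OF assms(1-4) K] by simp
  qed simp
  then show ?thesis using K by blast
next
  case False
  note X = assms(1,2) and Y = assms(3,4) and zbar = assms(8)
  have fejer: "dist (z (Suc k)) s \<le> dist (z k) s" if "s \<in> X \<inter> Y" for k s
    using dist_cCRM_le[OF X Y that] assms(6) by simp
  obtain s r where r: "r > 0" and ball: "cball s r \<subseteq> X \<inter> Y"
    using assms(9) by (meson ex_in_conv mem_interior_cball)
  have intX: "interior X \<noteq> {}" and intY: "interior Y \<noteq> {}" using assms(9) by auto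
  have sXY: "s \<in> X \<inter> Y" using r ball by (auto simp: subset_iff)
  define R where "R = dist (z 0) s + 1"
  have R: "R > 0" by (simp add: R_def add_nonneg_pos)
  have bounded: "dist (z k) s \<le> R" for k
    using lift_Suc_antimono_le[where f = "\<lambda>k. dist (z k) s", OF fejer[OF sXY], of 0 k]
    by (simp add: R_def)
  have "\<exists>N. \<forall>k\<ge>N. norm (norm (z (Suc k) - zbar) / norm (z k - zbar) - 0) < e" if e: "e > 0" for e
  proof -
    \<comment> \<open>The factor 8 collects three factors 2 (triangle inequality to the contact points, Fejer bound,
        strictness of the final inequality); \<open>R / r\<close> is the constant of the error bound.\<close>
    define \<epsilon> where "\<epsilon> = e * r / (8 * R)"
    have \<epsilon>: "\<epsilon> > 0" using e r R by (simp add: \<epsilon>_def)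
    obtain \<delta>1 where \<delta>1: "\<delta>1 > 0" and closeX: "\<And>y w \<nu>. dist y zbar < \<delta>1 \<Longrightarrow> dist w zbar < \<delta>1 \<Longrightarrow>
        unit_normal X w \<nu> \<Longrightarrow> \<nu> \<bullet> (y - w) \<le> 0 \<Longrightarrow> dist y (closest_point X y) \<le> \<epsilon> * dist y w"
      using dist_closest_point_small_on_supporting_halfspace[OF X intX _ assms(10) \<epsilon>] zbar by auto
    obtain \<delta>2 where \<delta>2: "\<delta>2 > 0" and closeY: "\<And>y w \<nu>. dist y zbar < \<delta>2 \<Longrightarrow> dist w zbar < \<delta>2 \<Longrightarrow>
        unit_normal Y w \<nu> \<Longrightarrow> \<nu> \<bullet> (y - w) \<le> 0 \<Longrightarrow> dist y (closest_point Y y) \<le> \<epsilon> * dist y w"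
      using dist_closest_point_small_on_supporting_halfspace[OF Y intY _ assms(11) \<epsilon>] zbar by auto
    have "min \<delta>1 \<delta>2 > 0" using \<delta>1 \<delta>2 by simp
    then obtain N where N: "\<And>k. k \<ge> N \<Longrightarrow> dist (z k) zbar < min \<delta>1 \<delta>2"
      using assms(7) unfolding lim_sequentially by blast
    have "norm (norm (z (Suc k) - zbar) / norm (z k - zbar) - 0) < e" if k: "k \<ge> N" for k
    proof -
      define y where "y = z (Suc k)"
      define D where "D = dist (z k) zbar"
      have yT: "y = cCRM X Y (z k)" by (simp add: y_def assms(6))
      have D: "D > 0" using False zbar by (auto simp: D_def)
      obtain u v \<mu> \<nu> where uv: "unit_normal X u \<mu>" "unit_normal Y v \<nu>"
        "\<mu> \<bullet> (y - u) \<le> 0" "\<nu> \<bullet> (y - v) \<le> 0" "dist u zbar \<le> D" "dist v zbar \<le> D"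
        using cCRM_supporting_halfspaces[OF X Y assms(5), of "z k"] False zbar
        unfolding yT D_def by (metis assms(6))
      have Dsmall: "D < \<delta>1" "D < \<delta>2" using N[OF k] by (auto simp: D_def)
      have yD: "dist y zbar \<le> D" using fejer[OF zbar] by (simp add: y_def D_def)
      have "dist y u \<le> 2 * D" "dist y v \<le> 2 * D"
        using dist_triangle2[of y u zbar] dist_triangle2[of y v zbar] yD uv(5,6) by auto
      then have eu: "\<epsilon> * dist y u \<le> \<epsilon> * (2 * D)" and ev: "\<epsilon> * dist y v \<le> \<epsilon> * (2 * D)"
        using \<epsilon> by (auto intro: mult_left_mono)
      have dX: "dist y (closest_point X y) \<le> \<epsilon> * (2 * D)"
        using closeX[OF _ _ uv(1,3)] yD uv(5) Dsmall eu by simp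
      have dY: "dist y (closest_point Y y) \<le> \<epsilon> * (2 * D)"
        using closeY[OF _ _ uv(2,4)] yD uv(6) Dsmall ev by simp
      have "closest_point X y \<in> X" "closest_point Y y \<in> Y"
        using X Y zbar by (auto intro: closest_point_in_set)
      then obtain q where q: "q \<in> X \<inter> Y" "dist y q \<le> \<epsilon> * (2 * D) / r * dist y s"
        using error_bound_interior[OF X(2) Y(2) ball r _ dX _ dY] by blast
      have "dist y zbar \<le> 2 * dist y q"
        using fejer_dist_limit_le[OF fejer[OF q(1)] assms(7)] by (simp add: y_def)
      also have "\<dots> \<le> 2 * (\<epsilon> * (2 * D) / r * R)"
      proof -
        have "\<epsilon> * (2 * D) / r * dist y s \<le> \<epsilon> * (2 * D) / r * R"
          using bounded[of "Suc k"] \<epsilon> D r by (intro mult_left_mono) (auto simp: y_def)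
        then show ?thesis using q(2) by linarith
      qed
      also have "\<dots> = (e / 2) * D" using r R by (simp add: \<epsilon>_def)
      also have "\<dots> < e * D" using e D by simp
      finally show ?thesis using D by (simp add: D_def y_def dist_norm divide_simps)
    qed
    then show ?thesis by blast
  qed
  then have "(\<lambda>k. norm (z (Suc k) - zbar) / norm (z k - zbar)) \<longlonglongrightarrow> 0"
    by (rule LIMSEQ_I)
  moreover have "z k \<noteq> zbar" for k using False zbar by auto
  ultimately show ?thesis using assms(7) by (simp add: converges_superlinearly_def)
qed

end
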